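(* Let $S=\langle L,\leq,\top,\bot,\Box,\boxtimes\rangle$ be an abstract provability structure and let $\triangle v$ be a one-variable APS term with $d(\triangle)\geq 1$. If $\mathsf{E}_S(\boxtimes)$ holds, then both $\mathsf{E}_S(\triangle)$ and $\mathsf{U}_S(\triangle)$ hold.
   Context: An abstract provability structure (APS) is a tuple $S=\langle L,\leq,\top,\bot,\Box,\boxtimes\rangle$ where $L$ is a nonempty set, $\leq$ is a partial order on $L$, $\top,\bot\in L$, and $\Box,\boxtimes$ are unary operations on $L$ such that for all $x,y\in L$: (C1) if $x\leq y$ then $\Box x\leq\Box y$ and $\boxtimes y\leq\boxtimes x$; (C2) $\top\leq\boxtimes\bot$; (C3) if $x\leq\Box y$ and $x\leq\boxtimes y$ then $x\leq\boxtimes\top$; (C4) $\boxtimes x\leq\Box\boxtimes x$; (C5) $x\leq\top$. (It is not assumed that $\bot$ is the least element.) A one-variable APS term $\triangle v$ is generated from the variable $v$ by finitely many applications of $\Box$ and $\boxtimes$; it induces a unary operation $x\mapsto\triangle x$ on $L$. The degree $d(\triangle)$ is the number of occurrences of $\boxtimes$ in $\triangle$. A fixed point of $\triangle v$ in $S$ is an element $p\in L$ with $\triangle p=p$. $\mathsf{E}_S(\triangle)$ means "$\triangle v$ has a fixed point in $S$"; $\mathsf{U}_S(\triangle)$ means "$\triangle v$ has at most one fixed point in $S$". In particular $\mathsf{E}_S(\boxtimes)$ means that there is $p\in L$ with $p=\boxtimes p$ (a Gödelian fixed point). *)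

theory Defs
  imports Main
begin

record 'a aps_struct =
  carrier :: "'a set"
  le :: "'a \<Rightarrow> 'a \<Rightarrow> bool"  (infixl "\<sqsubseteq>\<index>" 50)
  top_elem :: 'a  ("\<top>\<index>")
  bot_elem :: 'a  ("\<bottom>\<index>")
  box :: "'a \<Rightarrow> 'a"  ("\<box>\<index> _" [81] 80)
  boxtimes :: "'a \<Rightarrow> 'a"  ("\<boxtimes>\<index> _" [81] 80)

text \<open>
  Abstract provability structures. Only the restrictions of the order and of the
  operations to the carrier matter. \<open>\<bottom>\<close> is an arbitrary designated element: it is not
  required to be least.
\<close>

locale aps =
  fixes S :: "'a aps_struct" (structure)
  assumes top_closed: "\<top> \<in> carrier S"
    and bot_closed: "\<bottom> \<in> carrier S"
    and box_closed: "x \<in> carrier S \<Longrightarrow> \<box> x \<in> carrier S"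
    and boxtimes_closed: "x \<in> carrier S \<Longrightarrow> \<boxtimes> x \<in> carrier S"
    and le_refl: "reflp_on (carrier S) (le S)"
    and le_antisym: "antisymp_on (carrier S) (le S)"
    and le_trans: "transp_on (carrier S) (le S)"
    and C1_box: "\<lbrakk>x \<in> carrier S; y \<in> carrier S; x \<sqsubseteq> y\<rbrakk> \<Longrightarrow> \<box> x \<sqsubseteq> \<box> y"
    and C1_boxtimes: "\<lbrakk>x \<in> carrier S; y \<in> carrier S; x \<sqsubseteq> y\<rbrakk> \<Longrightarrow> \<boxtimes> y \<sqsubseteq> \<boxtimes> x"
    and C2: "\<top> \<sqsubseteq> \<boxtimes> \<bottom>"
    and C3: "\<lbrakk>x \<in> carrier S; y \<in> carrier S; x \<sqsubseteq> \<box> y; x \<sqsubseteq> \<boxtimes> y\<rbrakk> \<Longrightarrow> x \<sqsubseteq> \<boxtimes> \<top>"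
    and C4: "x \<in> carrier S \<Longrightarrow> \<boxtimes> x \<sqsubseteq> \<box> (\<boxtimes> x)"
    and C5: "x \<in> carrier S \<Longrightarrow> x \<sqsubseteq> \<top>"

datatype aps_term = Var | Box aps_term | Boxtimes aps_term

fun degree :: "aps_term \<Rightarrow> nat" where
  "degree Var = 0"
| "degree (Box t) = degree t"
| "degree (Boxtimes t) = Suc (degree t)"

fun term_op :: "'a aps_struct \<Rightarrow> aps_term \<Rightarrow> 'a \<Rightarrow> 'a" where
  "term_op S Var x = x"
| "term_op S (Box t) x = \<box>\<^bsub>S\<^esub> (term_op S t x)"
| "term_op S (Boxtimes t) x = \<boxtimes>\<^bsub>S\<^esub> (term_op S t x)"

definition fixed_point :: "'a aps_struct \<Rightarrow> aps_term \<Rightarrow> 'a \<Rightarrow> bool" where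
  "fixed_point S t p \<longleftrightarrow> p \<in> carrier S \<and> term_op S t p = p"

definition fp_exists :: "'a aps_struct \<Rightarrow> aps_term \<Rightarrow> bool" where
  "fp_exists S t \<longleftrightarrow> (\<exists>p. fixed_point S t p)"

text \<open>At most one fixed point; existence is not included.\<close>

definition fp_unique :: "'a aps_struct \<Rightarrow> aps_term \<Rightarrow> bool" where
  "fp_unique S t \<longleftrightarrow> (\<forall>p q. fixed_point S t p \<longrightarrow> fixed_point S t q \<longrightarrow> p = q)"

end

theory Submission
  imports Defs
begin

text \<open>
  A Goedelian fixed point is necessarily \<open>c = \<boxtimes>\<top>\<close>, the least value of \<open>\<boxtimes>\<close>. The up-set of \<open>c\<close>
  is closed under both operations, and \<open>\<boxtimes>\<close> sends all of it to \<open>c\<close>; hence a term of positive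
  degree takes values in this up-set and is constant on it, so that this constant value is its
  only fixed point.
\<close>

context aps
begin

lemma le_trans':
  assumes "x \<sqsubseteq> y" "y \<sqsubseteq> z" "x \<in> carrier S" "y \<in> carrier S" "z \<in> carrier S"
  shows "x \<sqsubseteq> z"
  using transp_onD[OF le_trans] assms by blast

lemma le_antisym':
  assumes "x \<sqsubseteq> y" "y \<sqsubseteq> x" "x \<in> carrier S" "y \<in> carrier S"
  shows "x = y"
  using antisymp_onD[OF le_antisym] assms by blast

lemma term_op_closed: "x \<in> carrier S \<Longrightarrow> term_op S t x \<in> carrier S"
  by (induction t) (simp_all add: box_closed boxtimes_closed)

lemma boxtimes_top_le: "x \<in> carrier S \<Longrightarrow> \<boxtimes> \<top> \<sqsubseteq> \<boxtimes> x"
  by (simp add: C1_boxtimes C5 top_closed)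

text \<open>Since \<open>p = \<boxtimes> p\<close>, C4 reads
  \<open>p \<sqsubseteq> \<box> p\<close>, so C3 applies with both of its variables equal to
  \<open>p\<close>.\<close>

lemma boxtimes_fixed_point_eq:
  assumes "p \<in> carrier S" "\<boxtimes> p = p"
  shows "p = \<boxtimes> \<top>"
proof (rule le_antisym')
  have "p \<sqsubseteq> \<box> p" "p \<sqsubseteq> \<boxtimes> p"
    using C4[of p] reflp_onD[OF le_refl] assms by simp_all
  then show "p \<sqsubseteq> \<boxtimes> \<top>"
    using C3 assms by blast
  show "\<boxtimes> \<top> \<sqsubseteq> p"
    using boxtimes_top_le[of p] assms by simp
qed (use assms boxtimes_closed top_closed in auto)

text \<open>C4 at \<open>\<top>\<close> puts \<open>\<boxtimes> \<top>\<close> below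
  \<open>\<box> (\<boxtimes> \<top>)\<close>; monotonicity of \<open>\<box>\<close> does the
  rest.\<close>

lemma boxtimes_top_le_box:
  assumes "x \<in> carrier S" "\<boxtimes> \<top> \<sqsubseteq> x"
  shows "\<boxtimes> \<top> \<sqsubseteq> \<box> x"
  by (rule le_trans'[of _ "\<box> (\<boxtimes> \<top>)"])
    (simp_all add: C4 C1_box assms box_closed boxtimes_closed top_closed)

text \<open>The disjunction lets the induction reach \<open>Var\<close>, where the degree is 0 and
  the bound must come from \<open>x\<close> itself.\<close>

lemma boxtimes_top_le_term_op:
  assumes "x \<in> carrier S" "degree t \<ge> 1 \<or> \<boxtimes> \<top> \<sqsubseteq> x"
  shows "\<boxtimes> \<top> \<sqsubseteq> term_op S t x"
  using assms(2)
  by (induction t) (use assms(1) in \<open>simp_all add: boxtimes_top_le_box boxtimes_top_le term_op_closed\<close>)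

lemma boxtimes_eq_boxtimes_top:
  assumes "\<boxtimes> (\<boxtimes> \<top>) = \<boxtimes> \<top>" "x \<in> carrier S" "\<boxtimes> \<top> \<sqsubseteq> x"
  shows "\<boxtimes> x = \<boxtimes> \<top>"
proof (rule le_antisym')
  show "\<boxtimes> x \<sqsubseteq> \<boxtimes> \<top>"
    using C1_boxtimes[of "\<boxtimes> \<top>" x] assms boxtimes_closed top_closed by simp
qed (use assms boxtimes_top_le boxtimes_closed top_closed in auto)

text \<open>Outer boxes are peeled off until the outermost \<open>Boxtimes\<close>, whose value is
  \<open>\<boxtimes> \<top>\<close> at either argument.\<close>

lemma term_op_const:
  assumes fp: "\<boxtimes> (\<boxtimes> \<top>) = \<boxtimes> \<top>"
    and x: "x \<in> carrier S" "\<boxtimes> \<top> \<sqsubseteq> x"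
    and y: "y \<in> carrier S" "\<boxtimes> \<top> \<sqsubseteq> y"
    and "degree t \<ge> 1"
  shows "term_op S t x = term_op S t y"
  using assms(6)
proof (induction t)
  case (Boxtimes t)
  have "\<boxtimes> (term_op S t z) = \<boxtimes> \<top>" if "z \<in> carrier S" "\<boxtimes> \<top> \<sqsubseteq> z" for z
    using that by (simp add: boxtimes_eq_boxtimes_top[OF fp] boxtimes_top_le_term_op term_op_closed)
  then show ?case
    using x y by simp
qed simp_all

end

theorem corollary5p5:
  fixes S :: "'a aps_struct" and t :: aps_term
  assumes "aps S"
    and "degree t \<ge> 1"
    and "fp_exists S (Boxtimes Var)"
  shows "fp_exists S t \<and> fp_unique S t"
proof -
  interpret aps S by fact
  let ?c = "boxtimes S (top_elem S)"
  have fp: "boxtimes S ?c = ?c"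
    using assms(3) boxtimes_fixed_point_eq by (fastforce simp: fp_exists_def fixed_point_def)
  have c: "?c \<in> carrier S"
    by (simp add: boxtimes_closed top_closed)
  have above: "le S ?c (term_op S t x)" if "x \<in> carrier S" for x
    using boxtimes_top_le_term_op that assms(2) by blast
  have const: "term_op S t x = term_op S t ?c"
    if "x \<in> carrier S" "le S ?c x" for x
    using term_op_const[OF fp that c _ assms(2)] reflp_onD[OF le_refl c] by blast
  \<comment> \<open>The value at \<open>?c\<close> lies above \<open>?c\<close>, so
    \<open>const\<close> applies to that value itself.\<close>
  have "fixed_point S t (term_op S t ?c)"
    by (simp add: fixed_point_def term_op_closed c const above)
  \<comment> \<open>A fixed point is a value of the term, hence lies above
    \<open>?c\<close>.\<close>
  moreover have "p = term_op S t ?c" if "fixed_point S t p" for p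
    using that const above unfolding fixed_point_def by metis
  ultimately show ?thesis
    unfolding fp_exists_def fp_unique_def by metis
qed

end
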